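(* Let $X_n$ be the number of occurrences of a classical pattern $\sigma=\sigma_1\cdots\sigma_k$ in a random permutation of length $n$. Then there exists $c>0$ such that for all $n$, $$\operatorname{Var}(X_n)\ge c\,n^{2k-1}.$$
   Context: A classical pattern of length $k$ is given by a permutation $\sigma=\sigma_1\cdots\sigma_k$ of $[k]=\{1,\dots,k\}$, with no adjacency requirements on positions or values. An occurrence of $\sigma$ in a permutation $\pi=\pi_1\cdots\pi_n$ of $[n]$ is a subsequence $\pi_{i_1}\cdots\pi_{i_k}$, $i_1<\dots<i_k$, whose entries are in the same relative order as $\sigma_1\cdots\sigma_k$, i.e. $\pi_{i_a}<\pi_{i_b}$ if and only if $\sigma_a<\sigma_b$. A random permutation of length $n$ is one chosen uniformly at random from the set $S_n$ of all permutations of $[n]$, and $\operatorname{Var}$ denotes the variance with respect to this choice.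
   Formalization: The pattern length is taken to be k ≥ 2 and the bound is claimed for all n ≥ k, because the variance is 0 (so the inequality fails) when k = 1, or when 1 ≤ n < k. *)

theory Defs
  imports "HOL-Probability.Probability" "HOL-Combinatorics.Combinatorics"
begin

text \<open>
  A permutation of \<open>[n] = {1, \<dots>, n}\<close> is a function \<open>\<pi>\<close> with \<open>\<pi> permutes {1..n}\<close>; its one-line
  notation is \<open>\<pi> 1, \<dots>, \<pi> n\<close>.
\<close>

text \<open>
  An occurrence is represented by its positions \<open>i 1 < \<dots> < i k\<close> in \<open>[n]\<close>, that is by the strictly
  increasing map \<open>i\<close> from \<open>[k]\<close> to \<open>[n]\<close>. As \<open>\<pi>\<close> is injective, this is the same as the subsequence
  itself. The maps are taken in the extensional function space, so that two of them are equal
  iff they agree on \<open>[k]\<close> and counting them is meaningful.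
\<close>
definition occurrences :: "nat \<Rightarrow> (nat \<Rightarrow> nat) \<Rightarrow> nat \<Rightarrow> (nat \<Rightarrow> nat) \<Rightarrow> (nat \<Rightarrow> nat) set" where
  "occurrences k \<sigma> n \<pi> =
     {i \<in> {1..k} \<rightarrow>\<^sub>E {1..n}. strict_mono_on {1..k} i \<and>
        (\<forall>a\<in>{1..k}. \<forall>b\<in>{1..k}. \<pi> (i a) < \<pi> (i b) \<longleftrightarrow> \<sigma> a < \<sigma> b)}"

definition num_occurrences :: "nat \<Rightarrow> (nat \<Rightarrow> nat) \<Rightarrow> nat \<Rightarrow> (nat \<Rightarrow> nat) \<Rightarrow> nat" where
  "num_occurrences k \<sigma> n \<pi> = card (occurrences k \<sigma> n \<pi>)"

definition random_permutation :: "nat \<Rightarrow> (nat \<Rightarrow> nat) pmf" where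
  "random_permutation n = pmf_of_set {\<pi>. \<pi> permutes {1..n}}"

end

theory Submission
  imports Defs
begin

text \<open>
  The variance is bounded below by the Cauchy-Schwarz inequality
  \<open>Cov(X, Y)\<^sup>2 \<le> Var X \<cdot> Var Y\<close>, where \<open>X\<close> counts the occurrences of \<open>\<sigma>\<close> and \<open>Y\<close> is a simple
  statistic: the number of points of the graph of \<open>\<pi>\<close> in the corner square \<open>[m] \<times> [m]\<close>, with \<open>m\<close>
  a small constant multiple of \<open>n\<close>. As \<open>Y\<close> is linear in the indicators \<open>[\<pi> i = v]\<close>, the covariance
  can be computed exactly and \<open>Var Y\<close> is at most \<open>m\<^sup>2 / n\<close>.

  An occurrence of \<open>\<sigma>\<close> is the same thing as a pair of \<open>k\<close>-subsets of \<open>[n]\<close>, its positions \<open>I\<close> and its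
  values \<open>J\<close>, such that \<open>\<pi> (I a) = J (\<sigma> a)\<close> for all \<open>a\<close>. Each such system of \<open>k\<close> equations has
  \<open>(n - k)!\<close> solutions \<open>\<pi>\<close>. Put \<open>T = (n choose k)\<close> and \<open>W = (n - 1 choose k - 1)\<close>, and let \<open>w j i\<close> be
  the number of \<open>k\<close>-subsets of \<open>[n]\<close> whose \<open>j\<close>-th smallest element is \<open>i\<close>. Counting the triples
  \<open>(\<pi>, I, J)\<close> with \<open>\<pi> i = v\<close>, according to whether \<open>i\<close> is one of the positions, gives
  (\<open>sum_num_occurrences_through\<close>)

    \<open>n! Cov(X, [\<pi> i = v]) = (n - k)! (M i v - W\<^sup>2 / k)\<close>, \<open>M i v = (\<Sum>j. w j i * w (\<sigma> j) v)\<close>.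

  Here \<open>W\<^sup>2 / k\<close> is the average of \<open>M\<close> over all cells. At the corner cell \<open>i = v = 1\<close> only the first
  position and the smallest value can be involved, so \<open>M 1 1\<close> is \<open>W\<^sup>2\<close> if \<open>\<sigma> 1 = 1\<close> and \<open>0\<close>
  otherwise; for \<open>k \<ge> 2\<close> either value is at distance at least \<open>W\<^sup>2 / k\<close> from the average. By
  continuity, distance \<open>W\<^sup>2 / (2 k)\<close> with the same sign remains throughout the corner square
  (\<open>place_count_first_ge_corner\<close>, \<open>corner_deviation\<close>). Hence \<open>\<bar>Cov(X, Y)\<bar>\<close> is at least
  \<open>(n - k)! / n! * m\<^sup>2 * W\<^sup>2 / (2 k)\<close>, which is of order \<open>n ^ k\<close>, whereas \<open>Var Y\<close> is of order \<open>n\<close>; this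
  leaves order \<open>n ^ (2 * k - 1)\<close> for \<open>Var X\<close>.
\<close>

section \<open>Permutations with prescribed values\<close>

text \<open>
  Some permutation \<open>\<tau>\<close> of \<open>S\<close> satisfies the equations, because the complements of the
  two images of \<open>K\<close> have the same size. Composition with \<open>\<tau>\<close> then turns the permutations that fix
  \<open>p ` K\<close> pointwise into all the solutions.
\<close>
lemma card_permutes_interpolating:
  assumes S: "finite S" and K: "finite K" and p: "inj_on p K" "p ` K \<subseteq> S"
    and q: "inj_on q K" "q ` K \<subseteq> S"
  shows "card {\<pi>. \<pi> permutes S \<and> (\<forall>a\<in>K. \<pi> (p a) = q a)} = fact (card S - card K)"
proof -
  have cp: "card (p ` K) = card K" and cq: "card (q ` K) = card K"
    using p q by (simp_all add: card_image)
  have fin: "finite (p ` K)" "finite (q ` K)" using K by auto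
  have "card (S - p ` K) = card (S - q ` K)"
    using cp cq p(2) q(2) fin by (simp add: card_Diff_subset)
  then obtain g where g: "bij_betw g (S - p ` K) (S - q ` K)"
    using S by (metis finite_Diff finite_same_card_bij)
  define f where "f = (\<lambda>x. if x \<in> p ` K then q (inv_into K p x) else g x)"
  have fp: "f (p a) = q a" if "a \<in> K" for a using that p by (auto simp: f_def)
  have "bij_betw f (p ` K) (q ` K)"
    unfolding bij_betw_def
  proof
    show "inj_on f (p ` K)" using fp q(1) by (auto simp: inj_on_def)
    show "f ` p ` K = q ` K" using fp by force
  qed
  moreover have "bij_betw f (S - p ` K) (S - q ` K)"
    using g by (subst bij_betw_cong[of _ _ g]) (auto simp: f_def)
  ultimately have "bij_betw f (p ` K \<union> (S - p ` K)) (q ` K \<union> (S - q ` K))"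
    by (rule bij_betw_combine) auto
  then have bf: "bij_betw f S S" using p(2) q(2) by (simp add: Un_absorb1)
  define \<tau> where "\<tau> = (\<lambda>x. if x \<in> S then f x else x)"
  have \<tau>: "\<tau> permutes S"
  proof (rule bij_imp_permutes)
    show "bij_betw \<tau> S S" using bf by (subst bij_betw_cong[of _ _ f]) (auto simp: \<tau>_def)
  qed (auto simp: \<tau>_def)
  have \<tau>p: "\<tau> (p a) = q a" if "a \<in> K" for a using that fp p(2) by (auto simp: \<tau>_def)
  have "bij_betw (\<lambda>\<rho>. \<tau> \<circ> \<rho>) {\<rho>. \<rho> permutes (S - p ` K)}
          {\<pi>. \<pi> permutes S \<and> (\<forall>a\<in>K. \<pi> (p a) = q a)}"
  proof (rule bij_betw_byWitness[where f' = "\<lambda>\<pi>. inv \<tau> \<circ> \<pi>"])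
    show "\<forall>\<rho>\<in>{\<rho>. \<rho> permutes (S - p ` K)}. inv \<tau> \<circ> (\<tau> \<circ> \<rho>) = \<rho>"
      using permutes_inv_o(2)[OF \<tau>] by (simp add: o_assoc)
    show "\<forall>\<pi>\<in>{\<pi>. \<pi> permutes S \<and> (\<forall>a\<in>K. \<pi> (p a) = q a)}. \<tau> \<circ> (inv \<tau> \<circ> \<pi>) = \<pi>"
      using permutes_inv_o(1)[OF \<tau>] by (simp add: o_assoc)
    show "(\<lambda>\<rho>. \<tau> \<circ> \<rho>) ` {\<rho>. \<rho> permutes (S - p ` K)}
        \<subseteq> {\<pi>. \<pi> permutes S \<and> (\<forall>a\<in>K. \<pi> (p a) = q a)}"
    proof clarsimp
      fix \<rho> assume \<rho>: "\<rho> permutes (S - p ` K)"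
      then have "\<rho> permutes S" by (rule permutes_subset) auto
      moreover have "\<rho> (p a) = p a" if "a \<in> K" for a
        using \<rho> that by (auto intro: permutes_not_in)
      ultimately show "\<tau> \<circ> \<rho> permutes S \<and> (\<forall>a\<in>K. \<tau> (\<rho> (p a)) = q a)"
        using \<tau> \<tau>p by (simp add: permutes_compose)
    qed
    show "(\<lambda>\<pi>. inv \<tau> \<circ> \<pi>) ` {\<pi>. \<pi> permutes S \<and> (\<forall>a\<in>K. \<pi> (p a) = q a)}
        \<subseteq> {\<rho>. \<rho> permutes (S - p ` K)}"
    proof clarsimp
      fix \<pi> assume \<pi>: "\<pi> permutes S" and eq: "\<forall>a\<in>K. \<pi> (p a) = q a"
      have "inv \<tau> \<circ> \<pi> permutes S" using \<pi> \<tau> by (simp add: permutes_compose permutes_inv)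
      then show "inv \<tau> \<circ> \<pi> permutes S - p ` K"
      proof (rule permutes_superset)
        fix x assume "x \<in> S - (S - p ` K)"
        then obtain a where a: "a \<in> K" "x = p a" by blast
        then show "(inv \<tau> \<circ> \<pi>) x = x"
          using eq \<tau>p permutes_inverses(2)[OF \<tau>] by (metis comp_apply)
      qed
    qed
  qed
  then have "card {\<pi>. \<pi> permutes S \<and> (\<forall>a\<in>K. \<pi> (p a) = q a)}
      = card {\<rho>. \<rho> permutes (S - p ` K)}"
    by (simp add: bij_betw_same_card)
  also have "\<dots> = fact (card (S - p ` K))"
    using S by (intro card_permutations) auto
  also have "card (S - p ` K) = card S - card K"
    using cp p(2) fin by (simp add: card_Diff_subset)
  finally show ?thesis .
qed

section \<open>Strictly increasing maps and subsets\<close>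

lemma card_subsets_containing:
  assumes A: "finite A" and F: "F \<subseteq> A" "card F \<le> k"
  shows "card {S. S \<subseteq> A \<and> card S = k \<and> F \<subseteq> S} = (card A - card F) choose (k - card F)"
proof -
  have finF: "finite F" using A F finite_subset by blast
  have "bij_betw (\<lambda>R. F \<union> R) {R. R \<subseteq> A - F \<and> card R = k - card F}
     {S. S \<subseteq> A \<and> card S = k \<and> F \<subseteq> S}"
  proof (rule bij_betw_byWitness[where f' = "\<lambda>S. S - F"])
    show "(\<lambda>R. F \<union> R) ` {R. R \<subseteq> A - F \<and> card R = k - card F}
        \<subseteq> {S. S \<subseteq> A \<and> card S = k \<and> F \<subseteq> S}"
    proof clarsimp
      fix R assume R: "R \<subseteq> A - F" "card R = k - card F"
      then have "finite R" using A finite_subset by blast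
      then have "card (F \<union> R) = card F + card R"
        using R finF by (intro card_Un_disjoint) auto
      then show "F \<subseteq> A \<and> R \<subseteq> A \<and> card (F \<union> R) = k" using R F by auto
    qed
    show "(\<lambda>S. S - F) ` {S. S \<subseteq> A \<and> card S = k \<and> F \<subseteq> S}
        \<subseteq> {R. R \<subseteq> A - F \<and> card R = k - card F}"
      using finF by (auto simp: card_Diff_subset)
  qed auto
  then have "card {S. S \<subseteq> A \<and> card S = k \<and> F \<subseteq> S}
      = card {R. R \<subseteq> A - F \<and> card R = k - card F}"
    by (simp add: bij_betw_same_card)
  also have "\<dots> = card (A - F) choose (k - card F)" using A by (intro n_subsets) auto
  finally show ?thesis using F finF by (simp add: card_Diff_subset)
qed

definition increasing_maps :: "nat \<Rightarrow> nat \<Rightarrow> (nat \<Rightarrow> nat) set" where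
  "increasing_maps k n = {I \<in> {1..k} \<rightarrow>\<^sub>E {1..n}. strict_mono_on {1..k} I}"

lemma finite_increasing_maps [simp]: "finite (increasing_maps k n)"
proof (rule finite_subset)
  show "increasing_maps k n \<subseteq> {1..k} \<rightarrow>\<^sub>E {1..n}" by (auto simp: increasing_maps_def)
qed (auto intro: finite_PiE)

lemma increasing_mapsD:
  assumes "I \<in> increasing_maps k n"
  shows "inj_on I {1..k}" "I ` {1..k} \<subseteq> {1..n}"
  using assms by (auto simp: increasing_maps_def strict_mono_on_imp_inj_on)

text \<open>
  Increasing maps are the convenient form of \<open>k\<close>-subsets when the \<open>j\<close>-th smallest element is needed;
  subsets are the convenient form for counting. A \<open>k\<close>-subset is listed increasingly by its sorted list,
  and by no other increasing map.
\<close>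
lemma bij_betw_increasing_maps_subsets:
  "bij_betw (\<lambda>I. I ` {1..k}) (increasing_maps k n) {S. S \<subseteq> {1..n} \<and> card S = k}"
  unfolding bij_betw_def
proof
  show "inj_on (\<lambda>I. I ` {1..k}) (increasing_maps k n)"
  proof (rule inj_onI)
    fix I J assume I: "I \<in> increasing_maps k n" and J: "J \<in> increasing_maps k n"
      and eq: "I ` {1..k} = J ` {1..k}"
    have srt: "sorted_list_of_set (H ` {1..k}) = map H [1..<Suc k]"
      if "H \<in> increasing_maps k n" for H
    proof -
      have sm: "strict_mono_on {1..k} H" using that by (simp add: increasing_maps_def)
      have "sorted_wrt (<) (map H [1..<Suc k])"
        using sm by (auto simp: sorted_wrt_iff_nth_less strict_mono_on_def simp del: upt_Suc)
      moreover have "set (map H [1..<Suc k]) = H ` {1..k}" by auto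
      ultimately show ?thesis
        by (metis sorted_list_of_set.idem_if_sorted_distinct strict_sorted_iff)
    qed
    have "map I [1..<Suc k] = map J [1..<Suc k]" using srt[OF I] srt[OF J] eq by simp
    then have "\<forall>a\<in>{1..k}. I a = J a" by auto
    with I J show "I = J"
      by (intro PiE_ext[of I "{1..k}" "\<lambda>_. {1..n}" J]) (auto simp: increasing_maps_def)
  qed
  show "(\<lambda>I. I ` {1..k}) ` increasing_maps k n = {S. S \<subseteq> {1..n} \<and> card S = k}"
  proof
    show "(\<lambda>I. I ` {1..k}) ` increasing_maps k n \<subseteq> {S. S \<subseteq> {1..n} \<and> card S = k}"
      using increasing_mapsD by (fastforce simp: card_image)
    show "{S. S \<subseteq> {1..n} \<and> card S = k} \<subseteq> (\<lambda>I. I ` {1..k}) ` increasing_maps k n"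
    proof clarify
      fix S :: "nat set" assume S: "S \<subseteq> {1..n}" "k = card S"
      then have fin: "finite S" using finite_subset by blast
      define xs where "xs = sorted_list_of_set S"
      have xs: "sorted_wrt (<) xs" "set xs = S" "length xs = card S"
        using fin by (auto simp: xs_def)
      define I where "I = restrict (\<lambda>a. xs ! (a - 1)) {1..card S}"
      have "strict_mono_on {1..card S} I"
      proof (rule strict_mono_onI)
        fix a b assume "a \<in> {1..card S}" "b \<in> {1..card S}" "a < b"
        then show "I a < I b" using xs by (auto simp: I_def sorted_wrt_iff_nth_less)
      qed
      moreover have im: "I ` {1..card S} = S"
      proof
        show "I ` {1..card S} \<subseteq> S"
          using xs by (auto simp: I_def intro!: nth_mem)
        show "S \<subseteq> I ` {1..card S}"
        proof
          fix x assume "x \<in> S"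
          then obtain r where "r < card S" "x = xs ! r" using xs by (metis in_set_conv_nth)
          then show "x \<in> I ` {1..card S}" by (intro image_eqI[of _ _ "Suc r"]) (auto simp: I_def)
        qed
      qed
      ultimately have "I \<in> increasing_maps (card S) n"
        using S by (auto simp: increasing_maps_def I_def)
      then show "S \<in> (\<lambda>I. I ` {1..card S}) ` increasing_maps (card S) n"
        using im by (metis imageI)
    qed
  qed
qed

lemma card_increasing_maps_image:
  "card {I \<in> increasing_maps k n. P (I ` {1..k})} = card {S. S \<subseteq> {1..n} \<and> card S = k \<and> P S}"
proof -
  have "bij_betw (\<lambda>I. I ` {1..k}) {I \<in> increasing_maps k n. P (I ` {1..k})}
     {S \<in> {S. S \<subseteq> {1..n} \<and> card S = k}. P S}"
    using bij_betw_increasing_maps_subsets[of k n] by (rule bij_betw_Collect) auto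
  then show ?thesis by (simp add: bij_betw_same_card conj_assoc)
qed

lemma card_increasing_maps_containing:
  assumes "F \<subseteq> {1..n}" "card F \<le> k"
  shows "card {I \<in> increasing_maps k n. F \<subseteq> I ` {1..k}} = (n - card F) choose (k - card F)"
  using card_increasing_maps_image[of k n "\<lambda>S. F \<subseteq> S"]
    card_subsets_containing[of "{1..n}" F k] assms by simp

section \<open>Occurrences as pairs of positions and values\<close>

text \<open>
  If \<open>I\<close> gives the positions of an occurrence, then the set of its values is listed increasingly by
  exactly one \<open>J\<close>, namely \<open>J b = \<pi> (I (inv \<sigma> b))\<close>. Having \<open>J\<close> as a second summation variable replaces
  the order conditions on \<open>\<pi>\<close> by equations, which are easy to count.
\<close>
lemma num_occurrences_eq_sum:
  assumes \<sigma>: "\<sigma> permutes {1..k}" and \<pi>: "\<pi> permutes {1..n}"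
  shows "num_occurrences k \<sigma> n \<pi> =
    (\<Sum>I\<in>increasing_maps k n. \<Sum>J\<in>increasing_maps k n. of_bool (\<forall>a\<in>{1..k}. \<pi> (I a) = J (\<sigma> a)))"
proof -
  let ?R = "\<lambda>I J. \<forall>a\<in>{1..k}. \<pi> (I a) = J (\<sigma> a)"
  have s_in: "\<sigma> a \<in> {1..k}" if "a \<in> {1..k}" for a using permutes_in_image[OF \<sigma>] that by blast
  have i_in: "inv \<sigma> a \<in> {1..k}" if "a \<in> {1..k}" for a
    using permutes_in_image[OF permutes_inv[OF \<sigma>]] that by blast
  have si: "\<sigma> (inv \<sigma> a) = a" "inv \<sigma> (\<sigma> a) = a" for a using permutes_inverses[OF \<sigma>] by auto
  have uniq: "card {J \<in> increasing_maps k n. ?R I J} = of_bool (I \<in> occurrences k \<sigma> n \<pi>)"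
    if I: "I \<in> increasing_maps k n" for I
  proof (cases "I \<in> occurrences k \<sigma> n \<pi>")
    case True
    define J where "J = restrict (\<lambda>b. \<pi> (I (inv \<sigma> b))) {1..k}"
    have "J \<in> increasing_maps k n"
      unfolding increasing_maps_def
    proof (intro CollectI conjI strict_mono_onI)
      show "J \<in> {1..k} \<rightarrow>\<^sub>E {1..n}"
      proof (rule PiE_I)
        fix b assume "b \<in> {1..k}"
        moreover from this have "I (inv \<sigma> b) \<in> {1..n}"
          using increasing_mapsD(2)[OF I] i_in by blast
        ultimately show "J b \<in> {1..n}"
          using permutes_in_image[OF \<pi>] by (simp add: J_def)
      qed (auto simp: J_def restrict_def)
      fix b c assume "b \<in> {1..k}" "c \<in> {1..k}" "b < c"
      then show "J b < J c"
        using True i_in[of b] i_in[of c] si by (simp add: J_def occurrences_def)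
    qed
    moreover have "?R I J" using s_in si by (simp add: J_def)
    moreover have "J' = J" if "J' \<in> increasing_maps k n" "?R I J'" for J'
    proof (rule PiE_ext)
      show "J' \<in> {1..k} \<rightarrow>\<^sub>E {1..n}" using that by (simp add: increasing_maps_def)
      show "J \<in> {1..k} \<rightarrow>\<^sub>E {1..n}" using calculation by (simp add: increasing_maps_def)
      fix b assume b: "b \<in> {1..k}"
      then have "\<pi> (I (inv \<sigma> b)) = J' (\<sigma> (inv \<sigma> b))" using that(2) i_in by blast
      then show "J' b = J b" using b by (simp add: si J_def)
    qed
    ultimately have "{J \<in> increasing_maps k n. ?R I J} = {J}" by blast
    then show ?thesis using True by simp
  next
    case False
    have "\<not> ?R I J" if J: "J \<in> increasing_maps k n" for J
    proof
      assume R: "?R I J"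
      have "\<pi> (I a) < \<pi> (I b) \<longleftrightarrow> \<sigma> a < \<sigma> b" if "a \<in> {1..k}" "b \<in> {1..k}" for a b
      proof -
        have "strict_mono_on {1..k} J" using J by (simp add: increasing_maps_def)
        then have "J (\<sigma> a) < J (\<sigma> b) \<longleftrightarrow> \<sigma> a < \<sigma> b"
          using s_in that by (meson strict_mono_on_less)
        then show ?thesis using R that by simp
      qed
      then have "I \<in> occurrences k \<sigma> n \<pi>"
        using I by (simp add: occurrences_def increasing_maps_def)
      with False show False by simp
    qed
    then have "{J \<in> increasing_maps k n. ?R I J} = {}" by blast
    then show ?thesis using False by simp
  qed
  have "(\<Sum>I\<in>increasing_maps k n. \<Sum>J\<in>increasing_maps k n. of_bool (?R I J)) =
     (\<Sum>I\<in>increasing_maps k n. of_bool (I \<in> occurrences k \<sigma> n \<pi>) :: nat)"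
    by (intro sum.cong refl) (simp add: sum_of_bool_eq uniq[symmetric] Int_def)
  also have "\<dots> = card (occurrences k \<sigma> n \<pi>)"
  proof -
    have "increasing_maps k n \<inter> occurrences k \<sigma> n \<pi> = occurrences k \<sigma> n \<pi>"
      by (auto simp: increasing_maps_def occurrences_def)
    then show ?thesis by (simp add: sum_of_bool_eq)
  qed
  finally show ?thesis by (simp add: num_occurrences_def)
qed

lemma card_permutes_embedding:
  assumes \<sigma>: "\<sigma> permutes {1..k}" and I: "I \<in> increasing_maps k n" and J: "J \<in> increasing_maps k n"
  shows "card {\<pi>. \<pi> permutes {1..n} \<and> (\<forall>a\<in>{1..k}. \<pi> (I a) = J (\<sigma> a))} = fact (n - k)"
proof -
  have im: "\<sigma> ` {1..k} = {1..k}" using permutes_image[OF \<sigma>] .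
  have "inj_on (J \<circ> \<sigma>) {1..k}"
    using increasing_mapsD(1)[OF J] im permutes_inj_on[OF \<sigma>] by (intro comp_inj_on) auto
  moreover have "(J \<circ> \<sigma>) ` {1..k} \<subseteq> {1..n}"
    using increasing_mapsD(2)[OF J] im by (simp only: image_comp[symmetric])
  ultimately show ?thesis
    using card_permutes_interpolating[of "{1..n}" "{1..k}" I "J \<circ> \<sigma>"] increasing_mapsD[OF I]
    by simp
qed

text \<open>
  If \<open>i\<close> is one of the positions then the value of \<open>\<pi>\<close> at \<open>i\<close> is already prescribed by \<open>J\<close>; otherwise
  \<open>\<pi> i = v\<close> is one more independent equation, solvable iff \<open>v\<close> is not among the prescribed values.
\<close>
lemma card_permutes_embedding_and_value:
  assumes \<sigma>: "\<sigma> permutes {1..k}" and I: "I \<in> increasing_maps k n" and J: "J \<in> increasing_maps k n"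
    and i: "i \<in> {1..n}" and v: "v \<in> {1..n}"
  shows "real (card {\<pi>. \<pi> permutes {1..n} \<and> (\<forall>a\<in>{1..k}. \<pi> (I a) = J (\<sigma> a)) \<and> \<pi> i = v}) =
    fact (n - k) * (\<Sum>j\<in>{1..k}. of_bool (I j = i) * of_bool (J (\<sigma> j) = v))
    + fact (n - Suc k) * (of_bool (i \<notin> I ` {1..k}) * of_bool (v \<notin> J ` {1..k}))"
    (is "real (card ?S) = _ * ?s + _")
proof (cases "i \<in> I ` {1..k}")
  case True
  then obtain j where j: "j \<in> {1..k}" "i = I j" by blast
  have "?s = (\<Sum>j'\<in>{1..k}. if j' = j then of_bool (J (\<sigma> j) = v) else 0)"
  proof (intro sum.cong refl)
    fix j' assume "j' \<in> {1..k}"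
    then have "I j' = i \<longleftrightarrow> j' = j"
      unfolding j(2) using increasing_mapsD(1)[OF I] j(1) by (simp only: inj_on_eq_iff)
    then show "of_bool (I j' = i) * of_bool (J (\<sigma> j') = v)
        = (if j' = j then of_bool (J (\<sigma> j) = v) else (0 :: real))" by simp
  qed
  then have s: "?s = of_bool (J (\<sigma> j) = v)" using j by simp
  show ?thesis
  proof (cases "J (\<sigma> j) = v")
    case eq: True
    have "?S = {\<pi>. \<pi> permutes {1..n} \<and> (\<forall>a\<in>{1..k}. \<pi> (I a) = J (\<sigma> a))}"
      using j(1) unfolding j(2) eq[symmetric] by auto
    then have "card ?S = fact (n - k)" using card_permutes_embedding[OF \<sigma> I J] by simp
    then show ?thesis using s True eq by simp
  next
    case False
    then have "?S = {}" using j by auto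
    then have "card ?S = 0" by (simp only: card.empty)
    then show ?thesis using s True False by simp
  qed
next
  case False
  then have s: "?s = 0" by (intro sum.neutral) auto
  have im: "\<sigma> ` {1..k} = {1..k}" using permutes_image[OF \<sigma>] .
  then have imJ: "(J \<circ> \<sigma>) ` {1..k} = J ` {1..k}" by (simp only: image_comp[symmetric])
  show ?thesis
  proof (cases "v \<in> J ` {1..k}")
    case True
    then have "v \<in> (J \<circ> \<sigma>) ` {1..k}" by (simp only: imJ)
    then obtain a where a: "a \<in> {1..k}" "v = J (\<sigma> a)" by auto
    have "?S = {}"
    proof (rule ccontr)
      assume "?S \<noteq> {}"
      then obtain \<pi> where "\<pi> \<in> ?S" by blast
      then have \<pi>: "\<pi> permutes {1..n}" "\<pi> (I a) = v" "\<pi> i = v" using a by auto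
      then have "I a = i" using permutes_inj[OF \<pi>(1)] by (metis injD)
      with False a show False by blast
    qed
    then have "card ?S = 0" by (simp only: card.empty)
    then show ?thesis using s True by simp
  next
    case notin: False
    \<comment> \<open>The index \<open>0\<close>, which \<open>{1..k}\<close> leaves free, carries the additional equation.\<close>
    let ?p = "I(0 := i)" and ?q = "(J \<circ> \<sigma>)(0 := v)"
    have ins: "?p ` insert 0 {1..k} = insert i (I ` {1..k})"
      "?q ` insert 0 {1..k} = insert v ((J \<circ> \<sigma>) ` {1..k})"
      by (auto simp: image_iff)
    have inj: "inj_on (J \<circ> \<sigma>) {1..k}"
      using increasing_mapsD(1)[OF J] im permutes_inj_on[OF \<sigma>] by (intro comp_inj_on) auto
    have inj_upd: "inj_on (f(0 := y)) (insert 0 {1..k})"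
      if "inj_on f {1..k}" "y \<notin> f ` {1..k}" for f :: "nat \<Rightarrow> nat" and y
    proof -
      have "(f(0 := y)) ` ({1..k} - {0}) = f ` {1..k}" by (intro image_cong) auto
      then show ?thesis
        using inj_on_fun_updI[OF that, of 0] that(2) by (simp only: inj_on_insert fun_upd_same simp_thms)
    qed
    have "?S = {\<pi>. \<pi> permutes {1..n} \<and> (\<forall>a\<in>insert 0 {1..k}. \<pi> (?p a) = ?q a)}"
      by auto
    moreover have "card \<dots> = fact (card {1..n} - card (insert 0 {1..k}))"
    proof (rule card_permutes_interpolating)
      show "inj_on ?p (insert 0 {1..k})" by (rule inj_upd[OF increasing_mapsD(1)[OF I] False])
      show "?p ` insert 0 {1..k} \<subseteq> {1..n}"
        unfolding ins using increasing_mapsD(2)[OF I] i by simp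
      show "inj_on ?q (insert 0 {1..k})"
        using notin by (intro inj_upd[OF inj]) (simp only: imJ not_False_eq_True)
      show "?q ` insert 0 {1..k} \<subseteq> {1..n}"
        unfolding ins imJ using increasing_mapsD(2)[OF J] v by simp
    qed auto
    ultimately show ?thesis using s False notin by simp
  qed
qed

section \<open>Subsets with a given element in a given place\<close>

definition place_count :: "nat \<Rightarrow> nat \<Rightarrow> nat \<Rightarrow> nat \<Rightarrow> real" where
  "place_count k n j i = real (card {I \<in> increasing_maps k n. I j = i})"

lemma place_count_nonneg [simp]: "0 \<le> place_count k n j i"
  by (simp add: place_count_def)

lemma place_count_eq_sum: "place_count k n j i = (\<Sum>I\<in>increasing_maps k n. of_bool (I j = i))"
  by (simp add: place_count_def Int_def)

lemma sum_place_count: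
  assumes k: "1 \<le> k" and i: "i \<in> {1..n}"
  shows "(\<Sum>j\<in>{1..k}. place_count k n j i) = real ((n - 1) choose (k - 1))"
proof -
  have "(\<Sum>j\<in>{1..k}. of_bool (I j = i)) = (of_bool (i \<in> I ` {1..k}) :: real)"
    if "I \<in> increasing_maps k n" for I
  proof (cases "i \<in> I ` {1..k}")
    case True
    then obtain j where j: "j \<in> {1..k}" "i = I j" by blast
    then have "{1..k} \<inter> {j. I j = i} = {j}"
      using inj_onD[OF increasing_mapsD(1)[OF that]] by blast
    then show ?thesis using True by simp
  next
    case False
    then have "{1..k} \<inter> {j. I j = i} = {}" by auto
    then show ?thesis using False by simp
  qed
  moreover have "(\<Sum>j\<in>{1..k}. place_count k n j i)
      = (\<Sum>I\<in>increasing_maps k n. \<Sum>j\<in>{1..k}. of_bool (I j = i))"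
    unfolding place_count_eq_sum by (rule sum.swap)
  ultimately have "(\<Sum>j\<in>{1..k}. place_count k n j i)
      = (\<Sum>I\<in>increasing_maps k n. of_bool (i \<in> I ` {1..k}))"
    by simp
  also have "\<dots> = real (card {I \<in> increasing_maps k n. {i} \<subseteq> I ` {1..k}})"
    by (simp add: Int_def)
  also have "\<dots> = real ((n - 1) choose (k - 1))"
    using card_increasing_maps_containing[of "{i}" n k] i k by simp
  finally show ?thesis .
qed

lemma card_increasing_maps: "card (increasing_maps k n) = n choose k"
  using card_increasing_maps_containing[of "{}" n k] by simp

lemma card_increasing_maps_avoiding:
  assumes k: "1 \<le> k" and i: "i \<in> {1..n}"
  shows "real (card {I \<in> increasing_maps k n. i \<notin> I ` {1..k}})
    = real (n choose k) - real ((n - 1) choose (k - 1))"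
proof -
  have "{I \<in> increasing_maps k n. i \<notin> I ` {1..k}}
      = increasing_maps k n - {I \<in> increasing_maps k n. {i} \<subseteq> I ` {1..k}}"
    by auto
  moreover have "card {I \<in> increasing_maps k n. {i} \<subseteq> I ` {1..k}} = (n - 1) choose (k - 1)"
    using card_increasing_maps_containing[of "{i}" n k] i k by simp
  moreover have "card {I \<in> increasing_maps k n. {i} \<subseteq> I ` {1..k}} \<le> card (increasing_maps k n)"
    by (intro card_mono) auto
  moreover have "card (increasing_maps k n - {I \<in> increasing_maps k n. {i} \<subseteq> I ` {1..k}})
      = card (increasing_maps k n) - card {I \<in> increasing_maps k n. {i} \<subseteq> I ` {1..k}}"
    by (rule card_Diff_subset) auto
  ultimately show ?thesis by (simp add: card_increasing_maps of_nat_diff)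
qed

text \<open>
  A \<open>k\<close>-subset that contains \<open>i\<close>, but not as its least element, contains some \<open>t < i\<close> as well; the
  union bound over \<open>t\<close> gives the error term.
\<close>
lemma place_count_first_ge:
  assumes k: "2 \<le> k" and i: "i \<in> {1..n}"
  shows "real ((n - 1) choose (k - 1)) - real (i - 1) * real ((n - 2) choose (k - 2))
    \<le> place_count k n 1 i"
proof -
  let ?A = "\<lambda>F. {I \<in> increasing_maps k n. F \<subseteq> I ` {1..k}}"
  have "?A {i} \<subseteq> {I \<in> increasing_maps k n. I 1 = i} \<union> (\<Union>t\<in>{1..<i}. ?A {t, i})"
  proof
    fix I assume "I \<in> ?A {i}"
    then have I: "I \<in> increasing_maps k n" and "i \<in> I ` {1..k}" by auto
    then obtain j where j: "j \<in> {1..k}" "I j = i" by blast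
    show "I \<in> {I \<in> increasing_maps k n. I 1 = i} \<union> (\<Union>t\<in>{1..<i}. ?A {t, i})"
    proof (cases "j = 1")
      case False
      have one: "1 \<in> {1..k}" using k by simp
      have "I 1 < I j"
        using I j False one by (auto simp: increasing_maps_def strict_mono_on_def)
      moreover have "1 \<le> I 1" using increasing_mapsD(2)[OF I] one by fastforce
      moreover have "{I 1, i} \<subseteq> I ` {1..k}" using j one by blast
      ultimately show ?thesis using I j by (intro UnI2 UN_I[of "I 1"]) auto
    qed (use I j in auto)
  qed
  then have "card (?A {i})
      \<le> card ({I \<in> increasing_maps k n. I 1 = i} \<union> (\<Union>t\<in>{1..<i}. ?A {t, i}))"
    by (intro card_mono) auto
  also have "\<dots> \<le> card {I \<in> increasing_maps k n. I 1 = i} + card (\<Union>t\<in>{1..<i}. ?A {t, i})"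
    by (rule card_Un_le)
  also have "card (\<Union>t\<in>{1..<i}. ?A {t, i}) \<le> (\<Sum>t\<in>{1..<i}. card (?A {t, i}))"
    by (rule card_UN_le) simp
  also have "(\<Sum>t\<in>{1..<i}. card (?A {t, i})) = (\<Sum>t\<in>{1..<i}. (n - 2) choose (k - 2))"
  proof (rule sum.cong[OF refl])
    fix t assume t: "t \<in> {1..<i}"
    then have "card {t, i} = 2" by auto
    then show "card (?A {t, i}) = (n - 2) choose (k - 2)"
      using card_increasing_maps_containing[of "{t, i}" n k] t i k by simp
  qed
  also have "\<dots> = (i - 1) * ((n - 2) choose (k - 2))" by simp
  also have "card (?A {i}) = (n - 1) choose (k - 1)"
    using card_increasing_maps_containing[of "{i}" n k] i k by simp
  finally have "real ((n - 1) choose (k - 1))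
      \<le> real (card {I \<in> increasing_maps k n. I 1 = i} + (i - 1) * ((n - 2) choose (k - 2)))"
    by (simp only: of_nat_le_iff)
  then show ?thesis by (simp only: place_count_def of_nat_add of_nat_mult)
qed

lemma corner_side_le:
  fixes k n :: nat
  assumes k: "2 \<le> k" and n: "k \<le> n"
  shows "n div (8 * k\<^sup>2) + 1 \<le> n"
proof -
  have "n div (8 * k\<^sup>2) < n" using k n by (intro div_less_dividend) (auto intro: Suc_lessI)
  then show ?thesis by simp
qed

text \<open>
  For \<open>i\<close> small compared with \<open>n\<close>, almost all \<open>k\<close>-subsets that contain \<open>i\<close> have it as their least
  element. The relative error in \<open>place_count_first_ge\<close> is \<open>(i - 1) (k - 1) / (n - 1)\<close>, and the factor
  \<open>8 * k\<^sup>2\<close> is chosen so that this is at most \<open>1 / (4 k)\<close>. Adding \<open>1\<close> to the quotient keeps the square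
  nonempty for small \<open>n\<close>, so that all \<open>n \<ge> k\<close> are treated alike.
\<close>
lemma place_count_first_ge_corner:
  assumes k: "2 \<le> k" and n: "k \<le> n" and i: "i \<in> {1..n div (8 * k\<^sup>2) + 1}"
  shows "(1 - 1 / (4 * real k)) * real ((n - 1) choose (k - 1)) \<le> place_count k n 1 i"
proof -
  let ?W = "real ((n - 1) choose (k - 1))" and ?V = "real ((n - 2) choose (k - 2))"
  have k0: "real k \<ge> 2" and nk: "real n \<ge> real k" using k n by auto
  have "Suc (k - 2) * (Suc (n - 2) choose Suc (k - 2)) = Suc (n - 2) * ((n - 2) choose (k - 2))"
    by (rule Suc_times_binomial)
  moreover have "Suc (k - 2) = k - 1" "Suc (n - 2) = n - 1" using k n by auto
  ultimately have "(k - 1) * ((n - 1) choose (k - 1)) = (n - 1) * ((n - 2) choose (k - 2))"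
    by simp
  then have "real ((k - 1) * ((n - 1) choose (k - 1))) = real ((n - 1) * ((n - 2) choose (k - 2)))"
    by simp
  then have V: "(real k - 1) * ?W = (real n - 1) * ?V"
    using k n by (simp add: of_nat_diff)
  have "(i - 1) * (8 * k\<^sup>2) \<le> n div (8 * k\<^sup>2) * (8 * k\<^sup>2)" using i by (intro mult_right_mono) auto
  also have "\<dots> \<le> n" by simp
  finally have "real ((i - 1) * (8 * k\<^sup>2)) \<le> real n" by (simp only: of_nat_le_iff)
  then have i8: "real (i - 1) * (8 * (real k)\<^sup>2) \<le> real n" by simp
  have "(real (i - 1) * ?V * (4 * real k)) * (2 * real k * (real n - 1))
      = real (i - 1) * (8 * (real k)\<^sup>2) * ((real k - 1) * ?W)"
    unfolding V by (simp add: power2_eq_square)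
  also have "\<dots> \<le> real n * ((real k - 1) * ?W)"
    using i8 k0 by (intro mult_right_mono) auto
  also have "\<dots> = (real n * (real k - 1)) * ?W" by simp
  also have "\<dots> \<le> (2 * real k * (real n - 1)) * ?W"
  proof (rule mult_right_mono)
    have "real n * 1 \<le> real n * real k" "real k * 2 \<le> real k * real n"
      using k0 nk by (intro mult_left_mono; simp)+
    then show "real n * (real k - 1) \<le> 2 * real k * (real n - 1)"
      by (simp add: algebra_simps)
  qed simp
  finally have "real (i - 1) * ?V * (4 * real k) \<le> ?W"
    using k0 nk by (simp add: mult.commute)
  then have "real (i - 1) * ?V \<le> ?W / (4 * real k)" using k0 by (simp add: field_simps)
  moreover have "i \<in> {1..n}" using i corner_side_le[OF k n] by auto
  then have "?W - real (i - 1) * ?V \<le> place_count k n 1 i"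
    by (rule place_count_first_ge[OF k])
  ultimately show ?thesis by (simp add: algebra_simps)
qed

text \<open>
  Both weight vectors are almost concentrated on index \<open>1\<close>, so the sum is almost \<open>W\<^sup>2\<close> if \<open>\<sigma>\<close> pairs
  index \<open>1\<close> with itself, and almost \<open>0\<close> otherwise. As \<open>k \<ge> 2\<close>, the number \<open>1 / k\<close> is at distance at least
  \<open>1 / k\<close> from both \<open>0\<close> and \<open>1\<close>, and the errors use up at most half of that.
\<close>
lemma corner_deviation:
  fixes w w' :: "nat \<Rightarrow> real" and W :: real
  assumes \<sigma>: "\<sigma> permutes {1..k}" and k: "2 \<le> k"
    and w: "\<And>j. 0 \<le> w j" "sum w {1..k} = W" "(1 - 1 / (4 * real k)) * W \<le> w 1"
    and w': "\<And>j. 0 \<le> w' j" "sum w' {1..k} = W" "(1 - 1 / (4 * real k)) * W \<le> w' 1"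
  shows "W\<^sup>2 / (2 * real k)
     \<le> (if \<sigma> 1 = 1 then 1 else -1) * ((\<Sum>j\<in>{1..k}. w j * w' (\<sigma> j)) - W\<^sup>2 / real k)"
proof -
  define \<delta> where "\<delta> = 1 / (4 * real k)"
  have \<delta>: "0 \<le> \<delta>" "1 / real k = 4 * \<delta>" "4 * \<delta> \<le> 1 / 2" "1 / (2 * real k) = 2 * \<delta>"
    using k by (auto simp: \<delta>_def field_simps)
  have W0: "0 \<le> W" using w by (metis sum_nonneg)
  have W2: "W\<^sup>2 / (2 * real k) = 2 * \<delta> * W\<^sup>2" "W\<^sup>2 / real k = 4 * \<delta> * W\<^sup>2"
    by (simp_all add: \<delta>_def)
  have one: "1 \<in> {1..k}" using k by simp
  have \<sigma>in: "\<sigma> j \<in> {1..k}" if "j \<in> {1..k}" for j using permutes_in_image[OF \<sigma>] that by blast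
  show ?thesis
  proof (cases "\<sigma> 1 = 1")
    case True
    have "(1 - 2 * \<delta>) * W\<^sup>2 \<le> ((1 - \<delta>) * W) * ((1 - \<delta>) * W)"
    proof -
      have "((1 - \<delta>) * W) * ((1 - \<delta>) * W) = (1 - 2 * \<delta>) * W\<^sup>2 + (\<delta> * W)\<^sup>2"
        by (simp add: power2_eq_square algebra_simps)
      then show ?thesis by simp
    qed
    also have "\<dots> \<le> w 1 * w' 1"
      using w w' W0 \<delta> by (intro mult_mono) (auto simp: \<delta>_def)
    also have "\<dots> \<le> (\<Sum>j\<in>{1..k}. w j * w' (\<sigma> j))"
      using member_le_sum[of 1 "{1..k}" "\<lambda>j. w j * w' (\<sigma> j)"] one w w' True by simp
    finally have "(1 - 2 * \<delta>) * W\<^sup>2 \<le> (\<Sum>j\<in>{1..k}. w j * w' (\<sigma> j))" .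
    moreover have "8 * \<delta> * W\<^sup>2 \<le> 1 * W\<^sup>2" using \<delta> by (intro mult_right_mono) auto
    ultimately show ?thesis using True unfolding W2 by (simp add: algebra_simps)
  next
    case False
    have split: "sum f {1..k} = f 1 + sum f ({1..k} - {1})" for f :: "nat \<Rightarrow> real"
      using one by (simp add: sum.remove)
    have le: "w' j \<le> W" if "j \<in> {1..k}" for j
      using member_le_sum[of j "{1..k}" w'] that w' by simp
    have "w' (\<sigma> 1) + w' 1 \<le> W"
    proof -
      have "w' (\<sigma> 1) \<le> sum w' ({1..k} - {1})"
        using False \<sigma>in[OF one] w'(1) by (intro member_le_sum) auto
      then show ?thesis using split[of w'] w'(2) by simp
    qed
    then have a: "w' (\<sigma> 1) \<le> \<delta> * W" using w'(3) by (simp add: \<delta>_def algebra_simps)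
    have b: "sum w ({1..k} - {1}) \<le> \<delta> * W"
      using split[of w] w(2,3) by (simp add: \<delta>_def algebra_simps)
    have w1: "w 1 \<le> W" using member_le_sum[of 1 "{1..k}" w] one w by simp
    have "(\<Sum>j\<in>{1..k}. w j * w' (\<sigma> j))
        = w 1 * w' (\<sigma> 1) + (\<Sum>j\<in>{1..k} - {1}. w j * w' (\<sigma> j))"
      by (rule split)
    also have "\<dots> \<le> W * (\<delta> * W) + (\<Sum>j\<in>{1..k} - {1}. w j * W)"
      using a w1 w w' W0 le \<sigma>in by (intro add_mono mult_mono sum_mono mult_left_mono) auto
    also have "\<dots> = W * (\<delta> * W) + sum w ({1..k} - {1}) * W" by (simp add: sum_distrib_right)
    also have "\<dots> \<le> W * (\<delta> * W) + (\<delta> * W) * W"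
      using b W0 by (intro add_left_mono mult_right_mono) auto
    also have "\<dots> = 2 * \<delta> * W\<^sup>2" by (simp add: power2_eq_square)
    finally show ?thesis using False unfolding W2 by (simp add: algebra_simps)
  qed
qed

section \<open>Moments of the number of occurrences\<close>

lemma sum_num_occurrences_weighted:
  assumes \<sigma>: "\<sigma> permutes {1..k}"
  shows "(\<Sum>\<pi> | \<pi> permutes {1..n}. real (num_occurrences k \<sigma> n \<pi>) * of_bool (Q \<pi>)) =
    (\<Sum>I\<in>increasing_maps k n. \<Sum>J\<in>increasing_maps k n.
       real (card {\<pi>. \<pi> permutes {1..n} \<and> (\<forall>a\<in>{1..k}. \<pi> (I a) = J (\<sigma> a)) \<and> Q \<pi>}))"
proof -
  let ?P = "{\<pi>. \<pi> permutes {1..n}}" and ?R = "\<lambda>\<pi> I J. \<forall>a\<in>{1..k}. \<pi> (I a) = J (\<sigma> a)"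
  let ?E = "increasing_maps k n"
  have fin: "finite ?P" by (intro finite_permutations) simp
  have "(\<Sum>\<pi>\<in>?P. real (num_occurrences k \<sigma> n \<pi>) * of_bool (Q \<pi>))
     = (\<Sum>\<pi>\<in>?P. \<Sum>I\<in>?E. \<Sum>J\<in>?E. of_bool (?R \<pi> I J \<and> Q \<pi>))"
  proof (intro sum.cong refl)
    fix \<pi> assume "\<pi> \<in> ?P"
    then have "real (num_occurrences k \<sigma> n \<pi>) = (\<Sum>I\<in>?E. \<Sum>J\<in>?E. of_bool (?R \<pi> I J))"
      by (simp only: mem_Collect_eq num_occurrences_eq_sum[OF \<sigma>] of_nat_sum of_nat_of_bool)
    then show "real (num_occurrences k \<sigma> n \<pi>) * of_bool (Q \<pi>)
        = (\<Sum>I\<in>?E. \<Sum>J\<in>?E. of_bool (?R \<pi> I J \<and> Q \<pi>))"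
      by (simp only: sum_distrib_right of_bool_conj)
  qed
  also have "\<dots> = (\<Sum>I\<in>?E. \<Sum>\<pi>\<in>?P. \<Sum>J\<in>?E. of_bool (?R \<pi> I J \<and> Q \<pi>))"
    by (rule sum.swap)
  also have "\<dots> = (\<Sum>I\<in>?E. \<Sum>J\<in>?E. \<Sum>\<pi>\<in>?P. of_bool (?R \<pi> I J \<and> Q \<pi>))"
    by (intro sum.cong refl sum.swap)
  also have "\<dots> = (\<Sum>I\<in>?E. \<Sum>J\<in>?E.
      real (card {\<pi>. \<pi> permutes {1..n} \<and> ?R \<pi> I J \<and> Q \<pi>}))"
    using fin by (intro sum.cong refl) (simp add: Int_def)
  finally show ?thesis .
qed

lemma sum_num_occurrences:
  assumes \<sigma>: "\<sigma> permutes {1..k}"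
  shows "(\<Sum>\<pi> | \<pi> permutes {1..n}. real (num_occurrences k \<sigma> n \<pi>))
    = fact (n - k) * (real (n choose k))\<^sup>2"
  using sum_num_occurrences_weighted[OF \<sigma>, of n "\<lambda>_. True"] card_permutes_embedding[OF \<sigma>]
  by (simp add: card_increasing_maps power2_eq_square)

lemma choose_minus_one_times:
  assumes "1 \<le> k" "k \<le> n"
  shows "real n * real ((n - 1) choose (k - 1)) = real k * real (n choose k)"
proof -
  have "Suc (k - 1) * (Suc (n - 1) choose Suc (k - 1)) = Suc (n - 1) * ((n - 1) choose (k - 1))"
    by (rule Suc_times_binomial)
  moreover have "Suc (k - 1) = k" "Suc (n - 1) = n" using assms by auto
  ultimately have "n * ((n - 1) choose (k - 1)) = k * (n choose k)" by simp
  then show ?thesis by (metis of_nat_mult)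
qed

text \<open>
  The left-hand side counts the triples \<open>(\<pi>, I, J)\<close> with \<open>\<pi> i = v\<close> whose positions avoid \<open>i\<close>: there are
  \<open>T - W\<close> choices for each of \<open>I\<close> and \<open>J\<close>. Both sides vanish for \<open>n = k\<close>, where
  \<open>n - Suc k\<close> is a truncated difference.
\<close>
lemma avoiding_term_eq:
  assumes "1 \<le> k" "k \<le> n"
  defines "T \<equiv> real (n choose k)" and "W \<equiv> real ((n - 1) choose (k - 1))"
  shows "fact (n - Suc k) * (T - W)\<^sup>2 = fact (n - k) * (T\<^sup>2 / real n - W\<^sup>2 / real k)"
proof -
  have nW: "real n * W = real k * T"
    unfolding T_def W_def by (rule choose_minus_one_times) fact+
  have pos: "real k > 0" "real n > 0" using assms by auto
  have W: "W = real k * T / real n" using nW pos by (simp add: field_simps)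
  show ?thesis
  proof (cases "n = k")
    case True
    then show ?thesis using W pos by simp
  next
    case False
    then have "n - k = Suc (n - Suc k)" using assms by simp
    then have "fact (n - k) = (real n - real k) * fact (n - Suc k)"
      using assms by (simp only: fact_Suc) (simp add: of_nat_diff)
    moreover have "(T - W)\<^sup>2 = (real n - real k) * (T\<^sup>2 / real n - W\<^sup>2 / real k)"
      unfolding W using pos by (simp add: field_simps power2_eq_square)
    ultimately show ?thesis by simp
  qed
qed

lemma sum_num_occurrences_through:
  assumes \<sigma>: "\<sigma> permutes {1..k}" and k: "1 \<le> k" "k \<le> n"
    and i: "i \<in> {1..n}" and v: "v \<in> {1..n}"
  shows "(\<Sum>\<pi> | \<pi> permutes {1..n}. real (num_occurrences k \<sigma> n \<pi>) * of_bool (\<pi> i = v)) =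
    fact (n - k) * ((\<Sum>j\<in>{1..k}. place_count k n j i * place_count k n (\<sigma> j) v)
      + (real (n choose k))\<^sup>2 / real n - (real ((n - 1) choose (k - 1)))\<^sup>2 / real k)"
proof -
  let ?E = "increasing_maps k n"
  let ?u = "\<lambda>i I. of_bool (i \<notin> I ` {1..k}) :: real"
  let ?b = "\<lambda>j i I. of_bool (I j = i) :: real"
  have prod: "(\<Sum>I\<in>?E. \<Sum>J\<in>?E. f I * g J) = sum f ?E * sum g ?E" for f g :: "(nat \<Rightarrow> nat) \<Rightarrow> real"
    by (rule sum_product[symmetric])
  have u: "sum (?u x) ?E = real (n choose k) - real ((n - 1) choose (k - 1))"
    if "x \<in> {1..n}" for x
    using card_increasing_maps_avoiding[OF k(1) that] by (simp add: Int_def)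
  have "(\<Sum>\<pi> | \<pi> permutes {1..n}. real (num_occurrences k \<sigma> n \<pi>) * of_bool (\<pi> i = v))
     = (\<Sum>I\<in>?E. \<Sum>J\<in>?E. fact (n - k) * (\<Sum>j\<in>{1..k}. ?b j i I * ?b (\<sigma> j) v J)
          + fact (n - Suc k) * (?u i I * ?u v J))"
    unfolding sum_num_occurrences_weighted[OF \<sigma>]
    by (intro sum.cong refl card_permutes_embedding_and_value \<sigma> i v)
  also have "\<dots> = fact (n - k) * (\<Sum>I\<in>?E. \<Sum>J\<in>?E. \<Sum>j\<in>{1..k}. ?b j i I * ?b (\<sigma> j) v J)
       + fact (n - Suc k) * (\<Sum>I\<in>?E. \<Sum>J\<in>?E. ?u i I * ?u v J)"
    by (simp only: sum.distrib sum_distrib_left)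
  also have "(\<Sum>I\<in>?E. \<Sum>J\<in>?E. \<Sum>j\<in>{1..k}. ?b j i I * ?b (\<sigma> j) v J)
     = (\<Sum>I\<in>?E. \<Sum>j\<in>{1..k}. \<Sum>J\<in>?E. ?b j i I * ?b (\<sigma> j) v J)"
    by (intro sum.cong refl sum.swap)
  also have "\<dots> = (\<Sum>j\<in>{1..k}. \<Sum>I\<in>?E. \<Sum>J\<in>?E. ?b j i I * ?b (\<sigma> j) v J)"
    by (rule sum.swap)
  also have "\<dots> = (\<Sum>j\<in>{1..k}. place_count k n j i * place_count k n (\<sigma> j) v)"
    by (simp only: prod place_count_eq_sum)
  also have "(\<Sum>I\<in>?E. \<Sum>J\<in>?E. ?u i I * ?u v J)
     = (real (n choose k) - real ((n - 1) choose (k - 1)))\<^sup>2"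
    by (simp only: prod u[OF i] u[OF v] power2_eq_square)
  finally show ?thesis
    by (simp only: avoiding_term_eq[OF k] distrib_left add_diff_eq right_diff_distrib)
qed

section \<open>Points of the graph in the corner square\<close>

definition corner_count :: "nat \<Rightarrow> (nat \<Rightarrow> nat) \<Rightarrow> real" where
  "corner_count m \<pi> = (\<Sum>i\<in>{1..m}. \<Sum>v\<in>{1..m}. of_bool (\<pi> i = v))"

lemma card_permutes_value:
  assumes "i \<in> {1..n}" "v \<in> {1..n}"
  shows "card {\<pi>. \<pi> permutes {1..n} \<and> \<pi> i = v} = fact (n - 1)"
  using card_permutes_interpolating[of "{1..n}" "{()}" "\<lambda>_. i" "\<lambda>_. v"] assms by simp

lemma card_permutes_two_values:
  assumes "i \<in> {1..n}" "v \<in> {1..n}" "i' \<in> {1..n}" "v' \<in> {1..n}"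
  shows "real (card {\<pi>. \<pi> permutes {1..n} \<and> \<pi> i = v \<and> \<pi> i' = v'})
    = fact (n - 1) * (of_bool (i = i') * of_bool (v = v'))
      + fact (n - 2) * (of_bool (i \<noteq> i') * of_bool (v \<noteq> v'))"
proof (cases "i = i'")
  case True
  show ?thesis
  proof (cases "v = v'")
    case eq: True
    show ?thesis using card_permutes_value[OF assms(1,2)] unfolding True[symmetric] eq[symmetric]
      by simp
  next
    case False
    then have "{\<pi>. \<pi> permutes {1..n} \<and> \<pi> i = v \<and> \<pi> i' = v'} = {}" unfolding True by auto
    then show ?thesis using True False by (simp only: card.empty) simp
  qed
next
  case False
  show ?thesis
  proof (cases "v = v'")
    case True
    have "{\<pi>. \<pi> permutes {1..n} \<and> \<pi> i = v \<and> \<pi> i' = v'} = {}"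
      using False unfolding True by (auto dest!: permutes_inj injD)
    then show ?thesis using True False by (simp only: card.empty) simp
  next
    case neq: False
    let ?p = "\<lambda>b. if b then i else i'" and ?q = "\<lambda>b. if b then v else v'"
    have "card {\<pi>. \<pi> permutes {1..n} \<and> (\<forall>b\<in>{True, False}. \<pi> (?p b) = ?q b)}
        = fact (card {1..n} - card {True, False})"
      using assms False neq by (intro card_permutes_interpolating) (auto simp: inj_on_def)
    then show ?thesis using False neq by (simp add: ex_bool_eq numeral_2_eq_2)
  qed
qed

lemma sum_mult_corner_count:
  "(\<Sum>\<pi>\<in>P. f \<pi> * corner_count m \<pi>) = (\<Sum>i\<in>{1..m}. \<Sum>v\<in>{1..m}. \<Sum>\<pi>\<in>P. f \<pi> * of_bool (\<pi> i = v))"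
proof -
  have "(\<Sum>\<pi>\<in>P. f \<pi> * corner_count m \<pi>)
      = (\<Sum>\<pi>\<in>P. \<Sum>i\<in>{1..m}. \<Sum>v\<in>{1..m}. f \<pi> * of_bool (\<pi> i = v))"
    by (simp only: corner_count_def sum_distrib_left)
  also have "\<dots> = (\<Sum>i\<in>{1..m}. \<Sum>\<pi>\<in>P. \<Sum>v\<in>{1..m}. f \<pi> * of_bool (\<pi> i = v))"
    by (rule sum.swap)
  also have "\<dots> = (\<Sum>i\<in>{1..m}. \<Sum>v\<in>{1..m}. \<Sum>\<pi>\<in>P. f \<pi> * of_bool (\<pi> i = v))"
    by (intro sum.cong refl sum.swap)
  finally show ?thesis .
qed

lemma sum_corner_count:
  assumes "m \<le> n"
  shows "(\<Sum>\<pi> | \<pi> permutes {1..n}. corner_count m \<pi>) = fact (n - 1) * (real m)\<^sup>2"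
proof -
  have fin: "finite {\<pi>. \<pi> permutes {1..n}}" by (intro finite_permutations) simp
  have "(\<Sum>\<pi> | \<pi> permutes {1..n}. corner_count m \<pi>)
     = (\<Sum>i\<in>{1..m}. \<Sum>v\<in>{1..m}. \<Sum>\<pi> | \<pi> permutes {1..n}. of_bool (\<pi> i = v))"
    using sum_mult_corner_count[of "\<lambda>_. 1"] by simp
  also have "\<dots> = (\<Sum>i\<in>{1..m}. \<Sum>v\<in>{1..m}. fact (n - 1))"
  proof (intro sum.cong refl)
    fix i v assume "i \<in> {1..m}" "v \<in> {1..m}"
    then have "card {\<pi>. \<pi> permutes {1..n} \<and> \<pi> i = v} = fact (n - 1)"
      using assms by (intro card_permutes_value) auto
    then show "(\<Sum>\<pi> | \<pi> permutes {1..n}. of_bool (\<pi> i = v)) = (fact (n - 1) :: real)"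
      using fin by (simp add: Int_def)
  qed
  also have "\<dots> = fact (n - 1) * (real m)\<^sup>2" by (simp add: power2_eq_square)
  finally show ?thesis .
qed

lemma sum_corner_count_squared:
  assumes "m \<le> n"
  shows "(\<Sum>\<pi> | \<pi> permutes {1..n}. (corner_count m \<pi>)\<^sup>2)
    = fact (n - 1) * (real m)\<^sup>2 + fact (n - 2) * ((real m)\<^sup>2 - real m)\<^sup>2"
proof -
  let ?P = "{\<pi>. \<pi> permutes {1..n}}" and ?M = "{1..m}"
  have fin: "finite ?P" by (intro finite_permutations) simp
  have inner: "(\<Sum>\<pi>\<in>?P. corner_count m \<pi> * of_bool (\<pi> i = v))
      = fact (n - 1) + fact (n - 2) * (real m - 1)\<^sup>2" if i: "i \<in> ?M" and v: "v \<in> ?M" for i v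
  proof -
    have diag: "(\<Sum>i'\<in>?M. of_bool (x = i')) = (1 :: real)" if "x \<in> ?M" for x
    proof -
      have "?M \<inter> {i'. x = i'} = {x}" using that by auto
      then show ?thesis by simp
    qed
    have off: "(\<Sum>i'\<in>?M. of_bool (x \<noteq> i')) = real m - 1" if "x \<in> ?M" for x
    proof -
      have "?M \<inter> {i'. x \<noteq> i'} = ?M - {x}" by auto
      then show ?thesis using that by (simp add: of_nat_diff)
    qed
    have "(\<Sum>\<pi>\<in>?P. corner_count m \<pi> * of_bool (\<pi> i = v))
       = (\<Sum>\<pi>\<in>?P. of_bool (\<pi> i = v) * corner_count m \<pi>)"
      by (simp only: mult.commute)
    also have "\<dots> = (\<Sum>i'\<in>?M. \<Sum>v'\<in>?M. \<Sum>\<pi>\<in>?P. of_bool (\<pi> i = v) * of_bool (\<pi> i' = v'))"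
      by (rule sum_mult_corner_count)
    also have "\<dots> = (\<Sum>i'\<in>?M. \<Sum>v'\<in>?M.
        fact (n - 1) * (of_bool (i = i') * of_bool (v = v'))
        + fact (n - 2) * (of_bool (i \<noteq> i') * of_bool (v \<noteq> v')))"
    proof (intro sum.cong refl)
      fix i' v' assume "i' \<in> ?M" "v' \<in> ?M"
      then have "real (card {\<pi>. \<pi> permutes {1..n} \<and> \<pi> i = v \<and> \<pi> i' = v'})
        = fact (n - 1) * (of_bool (i = i') * of_bool (v = v'))
          + fact (n - 2) * (of_bool (i \<noteq> i') * of_bool (v \<noteq> v'))"
        using assms i v by (intro card_permutes_two_values) auto
      then show "(\<Sum>\<pi>\<in>?P. of_bool (\<pi> i = v) * of_bool (\<pi> i' = v'))
        = (fact (n - 1) :: real) * (of_bool (i = i') * of_bool (v = v'))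
          + fact (n - 2) * (of_bool (i \<noteq> i') * of_bool (v \<noteq> v'))"
        using fin by (simp only: of_bool_conj[symmetric] sum_of_bool_eq) (simp add: Int_def)
    qed
    also have "\<dots> = fact (n - 1) * ((\<Sum>i'\<in>?M. of_bool (i = i')) * (\<Sum>v'\<in>?M. of_bool (v = v')))
        + fact (n - 2) * ((\<Sum>i'\<in>?M. of_bool (i \<noteq> i')) * (\<Sum>v'\<in>?M. of_bool (v \<noteq> v')))"
      by (simp only: sum.distrib sum_distrib_left[symmetric] sum_product)
    also have "\<dots> = fact (n - 1) + fact (n - 2) * (real m - 1)\<^sup>2"
      by (simp only: diag[OF i] diag[OF v] off[OF i] off[OF v] power2_eq_square mult_1_right)
    finally show ?thesis .
  qed
  have "(\<Sum>\<pi>\<in>?P. (corner_count m \<pi>)\<^sup>2)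
      = (\<Sum>i\<in>?M. \<Sum>v\<in>?M. \<Sum>\<pi>\<in>?P. corner_count m \<pi> * of_bool (\<pi> i = v))"
    unfolding power2_eq_square by (rule sum_mult_corner_count)
  also have "\<dots> = (\<Sum>i\<in>?M. \<Sum>v\<in>?M. fact (n - 1) + fact (n - 2) * (real m - 1)\<^sup>2)"
    by (intro sum.cong refl inner)
  also have "\<dots> = fact (n - 1) * (real m)\<^sup>2 + fact (n - 2) * ((real m)\<^sup>2 - real m)\<^sup>2"
    by (simp add: power2_eq_square algebra_simps)
  finally show ?thesis .
qed

text \<open>
  The variance of a hypergeometric variable is at most its mean \<open>m\<^sup>2 / n\<close>. Here this comes down to
  \<open>n (m - 1)\<^sup>2 \<le> (n - 1) m\<^sup>2\<close>.
\<close>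
lemma corner_count_deviation_le:
  assumes m: "1 \<le> m" "m \<le> n" and n: "2 \<le> n"
  shows "(\<Sum>\<pi> | \<pi> permutes {1..n}. (corner_count m \<pi> - (real m)\<^sup>2 / real n)\<^sup>2)
    \<le> fact n * ((real m)\<^sup>2 / real n)"
proof -
  let ?P = "{\<pi>. \<pi> permutes {1..n}}"
  define \<nu> where "\<nu> = (real m)\<^sup>2 / real n"
  define g :: real where "g = fact (n - 2)"
  obtain r where r: "n = Suc (Suc r)" using n by (metis add_2_eq_Suc le_Suc_ex)
  have f: "fact (n - 1) = (real n - 1) * g" "fact n = real n * ((real n - 1) * g)"
    by (simp_all add: r g_def algebra_simps)
  have g: "g > 0" by (simp add: g_def)
  have np: "real n > 0" using n by simp
  have \<nu>n: "real n * \<nu> = (real m)\<^sup>2" using np by (simp add: \<nu>_def)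
  have card: "real (card ?P) = fact n"
    using card_permutations[of "{1..n}" n] by simp
  have "(\<Sum>\<pi>\<in>?P. (corner_count m \<pi> - \<nu>)\<^sup>2)
     = (\<Sum>\<pi>\<in>?P. (corner_count m \<pi>)\<^sup>2 - 2 * \<nu> * corner_count m \<pi> + \<nu>\<^sup>2)"
    by (intro sum.cong refl) (simp add: power2_diff)
  also have "\<dots> = (\<Sum>\<pi>\<in>?P. (corner_count m \<pi>)\<^sup>2) - 2 * \<nu> * (\<Sum>\<pi>\<in>?P. corner_count m \<pi>)
      + fact n * \<nu>\<^sup>2"
    by (simp only: sum.distrib sum_subtractf sum_distrib_left[symmetric] sum_constant card)
  also have "\<dots> = fact (n - 1) * (real m)\<^sup>2 + fact (n - 2) * ((real m)\<^sup>2 - real m)\<^sup>2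
      - 2 * \<nu> * (fact (n - 1) * (real m)\<^sup>2) + fact n * \<nu>\<^sup>2"
    using m by (simp only: sum_corner_count sum_corner_count_squared)
  also have "\<dots> = (real n - 1) * g * (real m)\<^sup>2
      + g * (((real m)\<^sup>2 - real m)\<^sup>2 - (real n - 1) * (real n * \<nu>) * \<nu>)"
    unfolding f g_def[symmetric] \<nu>n[symmetric] by (simp add: power2_eq_square algebra_simps)
  also have "\<dots> \<le> (real n - 1) * g * (real m)\<^sup>2 + 0"
  proof -
    have mn: "(real m - 1)\<^sup>2 * real n \<le> (real n - 1) * (real m)\<^sup>2"
    proof -
      have "0 \<le> real m * (real n - real m) + real n * (real m - 1)" using m by simp
      then show ?thesis by (simp add: power2_eq_square algebra_simps)
    qed
    have "((real m)\<^sup>2 - real m)\<^sup>2 = (real m)\<^sup>2 * (real m - 1)\<^sup>2"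
      by (simp add: power2_eq_square algebra_simps)
    also have "\<dots> = (real m)\<^sup>2 * ((real m - 1)\<^sup>2 * real n) / real n" using np by simp
    also have "\<dots> \<le> (real m)\<^sup>2 * ((real n - 1) * (real m)\<^sup>2) / real n"
      using mn np by (intro divide_right_mono mult_left_mono) auto
    also have "\<dots> = (real n - 1) * (real n * \<nu>) * \<nu>"
      unfolding \<nu>n by (simp add: \<nu>_def)
    finally show ?thesis using g by (intro add_left_mono) (simp add: mult_nonneg_nonpos)
  qed
  also have "\<dots> = fact n * \<nu>" unfolding f using \<nu>n by (simp add: mult.commute mult.left_commute)
  finally show ?thesis by (simp only: \<nu>_def)
qed

section \<open>The lower bound for the variance\<close>

text \<open>
  Since \<open>g\<close> has mean zero, \<open>f\<close> may be replaced by its deviation from the mean before the Cauchy-Schwarz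
  inequality is applied.
\<close>
lemma variance_pmf_of_set_Cauchy_Schwarz:
  fixes f g :: "'a \<Rightarrow> real"
  assumes S: "finite S" "S \<noteq> {}" and g: "sum g S = 0"
  shows "(\<Sum>x\<in>S. f x * g x)\<^sup>2
    \<le> (real (card S) * measure_pmf.variance (pmf_of_set S) f) * (\<Sum>x\<in>S. (g x)\<^sup>2)"
proof -
  define \<mu> where "\<mu> = measure_pmf.expectation (pmf_of_set S) f"
  have "(\<Sum>x\<in>S. f x * g x) = (\<Sum>x\<in>S. (f x - \<mu>) * g x)"
    using g by (simp add: left_diff_distrib sum_subtractf sum_distrib_left[symmetric])
  moreover have "real (card S) * measure_pmf.variance (pmf_of_set S) f = (\<Sum>x\<in>S. (f x - \<mu>)\<^sup>2)"
    using S by (simp add: integral_pmf_of_set \<mu>_def)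
  ultimately show ?thesis using Cauchy_Schwarz_ineq_sum[of "\<lambda>x. f x - \<mu>" g S] by simp
qed

theorem theorem6p3:
  fixes k :: nat and \<sigma> :: "nat \<Rightarrow> nat"
  assumes "k \<ge> 2" and "\<sigma> permutes {1..k}"
  shows "\<exists>c::real. c > 0 \<and>
    (\<forall>n\<ge>k. measure_pmf.variance (random_permutation n) (\<lambda>\<pi>. real (num_occurrences k \<sigma> n \<pi>))
              \<ge> c * real n ^ (2 * k - 1))"
proof -
  note k = assms(1) and \<sigma> = assms(2)
  define Q where "Q = real k ^ (k - 1)"
  have kp: "real k > 0" and Qp: "Q > 0" using k by (auto simp: Q_def)
  have "1 / (256 * real k ^ 6 * Q ^ 4) * real n ^ (2 * k - 1)
      \<le> measure_pmf.variance (random_permutation n) (\<lambda>\<pi>. real (num_occurrences k \<sigma> n \<pi>))"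
    if n: "k \<le> n" for n
  proof -
    let ?P = "{\<pi>. \<pi> permutes {1..n}}"
    define X where "X = (\<lambda>\<pi>. real (num_occurrences k \<sigma> n \<pi>))"
    define V where "V = measure_pmf.variance (random_permutation n) X"
    define m where "m = n div (8 * k\<^sup>2) + 1"
    define W where "W = real ((n - 1) choose (k - 1))"
    define T where "T = real (n choose k)"
    define \<nu> where "\<nu> = (real m)\<^sup>2 / real n"
    \<comment> \<open>The common sign of the deviations of \<open>M\<close> in the corner square.\<close>
    define s :: real where "s = (if \<sigma> 1 = 1 then 1 else -1)"
    define M where "M = (\<lambda>i v. \<Sum>j\<in>{1..k}. place_count k n j i * place_count k n (\<sigma> j) v)"
    have k1: "1 \<le> k" using k by simp
    have np: "real n > 0" using k n by simp
    have fin: "finite ?P" by (intro finite_permutations) simp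
    have ne: "?P \<noteq> {}" using permutes_id by blast
    have card: "real (card ?P) = fact n" using card_permutations[of "{1..n}" n] by simp
    have mn: "m \<le> n" unfolding m_def by (rule corner_side_le[OF k n])
    have m1: "1 \<le> m" by (simp add: m_def)
    have m_ge: "real n / (8 * (real k)\<^sup>2) \<le> real m"
    proof -
      have "n < (8 * k\<^sup>2) * m"
        using k dividend_less_times_div[of "8 * k\<^sup>2" n] by (simp add: m_def algebra_simps)
      then have "real n < real ((8 * k\<^sup>2) * m)" by (simp only: of_nat_less_iff)
      then show ?thesis using kp by (simp add: field_simps)
    qed

    have centred: "(\<Sum>\<pi>\<in>?P. corner_count m \<pi> - \<nu>) = 0"
    proof -
      have "fact n = real n * fact (n - 1)" using np by (simp add: fact_reduce)
      then show ?thesis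
        using np by (simp only: sum_subtractf sum_corner_count[OF mn] sum_constant card) (simp add: \<nu>_def)
    qed
    \<comment> \<open>The terms with \<open>T\<close> in the mixed moment cancel against the product of the means.\<close>
    have cov: "(\<Sum>\<pi>\<in>?P. X \<pi> * (corner_count m \<pi> - \<nu>))
        = fact (n - k) * (\<Sum>i\<in>{1..m}. \<Sum>v\<in>{1..m}. M i v - W\<^sup>2 / real k)"
    proof -
      have "(\<Sum>\<pi>\<in>?P. X \<pi> * (corner_count m \<pi> - \<nu>))
          = (\<Sum>\<pi>\<in>?P. X \<pi> * corner_count m \<pi>) - (\<Sum>\<pi>\<in>?P. X \<pi>) * \<nu>"
        by (simp only: right_diff_distrib sum_subtractf sum_distrib_right)
      also have "(\<Sum>\<pi>\<in>?P. X \<pi>) = fact (n - k) * T\<^sup>2"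
        unfolding X_def T_def by (rule sum_num_occurrences[OF \<sigma>])
      also have "(\<Sum>\<pi>\<in>?P. X \<pi> * corner_count m \<pi>)
          = (\<Sum>i\<in>{1..m}. \<Sum>v\<in>{1..m}. fact (n - k) * (M i v + T\<^sup>2 / real n - W\<^sup>2 / real k))"
        unfolding sum_mult_corner_count X_def M_def T_def W_def
        using mn by (intro sum.cong refl sum_num_occurrences_through \<sigma> k1 n) auto
      also have "\<dots> = fact (n - k) * (\<Sum>i\<in>{1..m}. \<Sum>v\<in>{1..m}. (M i v - W\<^sup>2 / real k) + T\<^sup>2 / real n)"
        by (simp only: sum_distrib_left) (simp only: algebra_simps)
      also have "\<dots> = fact (n - k) * (\<Sum>i\<in>{1..m}. \<Sum>v\<in>{1..m}. M i v - W\<^sup>2 / real k)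
          + fact (n - k) * T\<^sup>2 * \<nu>"
        by (simp only: sum.distrib) (simp add: \<nu>_def power2_eq_square algebra_simps)
      finally show ?thesis by simp
    qed
    have dev: "W\<^sup>2 / (2 * real k) \<le> s * (M i v - W\<^sup>2 / real k)"
      if i: "i \<in> {1..m}" and v: "v \<in> {1..m}" for i v
      unfolding s_def M_def
    proof (rule corner_deviation[OF \<sigma> k])
      show "(\<Sum>j\<in>{1..k}. place_count k n j i) = W" "(\<Sum>j\<in>{1..k}. place_count k n j v) = W"
        unfolding W_def by (rule sum_place_count[OF k1]; use i v mn in simp)+
      show "(1 - 1 / (4 * real k)) * W \<le> place_count k n 1 i"
        "(1 - 1 / (4 * real k)) * W \<le> place_count k n 1 v"
        using place_count_first_ge_corner[OF k n] i v unfolding W_def m_def by blast+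
    qed simp_all
    define D where "D = (\<Sum>i\<in>{1..m}. \<Sum>v\<in>{1..m}. M i v - W\<^sup>2 / real k)"
    have "(real m)\<^sup>2 * (W\<^sup>2 / (2 * real k)) = (\<Sum>i\<in>{1..m}. \<Sum>v\<in>{1..m}. W\<^sup>2 / (2 * real k))"
      by (simp add: power2_eq_square)
    also have "\<dots> \<le> (\<Sum>i\<in>{1..m}. \<Sum>v\<in>{1..m}. s * (M i v - W\<^sup>2 / real k))"
      by (intro sum_mono dev)
    also have "\<dots> = s * D" by (simp only: D_def sum_distrib_left)
    finally have "((real m)\<^sup>2 * (W\<^sup>2 / (2 * real k)))\<^sup>2 \<le> (s * D)\<^sup>2"
      by (intro power_mono) auto
    moreover have "(s * D)\<^sup>2 = D\<^sup>2" by (simp add: s_def power_mult_distrib)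
    ultimately have D: "((real m)\<^sup>2 * (W\<^sup>2 / (2 * real k)))\<^sup>2 \<le> D\<^sup>2" by simp

    have CS: "(fact (n - k) * D)\<^sup>2 \<le> (fact n * V) * (fact n * \<nu>)"
    proof -
      have "(fact (n - k) * D)\<^sup>2 \<le> (real (card ?P) * V) * (\<Sum>\<pi>\<in>?P. (corner_count m \<pi> - \<nu>)\<^sup>2)"
        unfolding D_def cov[symmetric] V_def random_permutation_def
        by (rule variance_pmf_of_set_Cauchy_Schwarz[OF fin ne centred])
      also have "\<dots> \<le> (fact n * V) * (fact n * \<nu>)"
      proof (unfold card, rule mult_left_mono)
        show "(\<Sum>\<pi>\<in>?P. (corner_count m \<pi> - \<nu>)\<^sup>2) \<le> fact n * \<nu>"
          unfolding \<nu>_def using m1 mn k n by (intro corner_count_deviation_le) auto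
        show "0 \<le> fact n * V" unfolding V_def by simp
      qed
      finally show ?thesis .
    qed
    have V0: "0 \<le> V" unfolding V_def by simp

    define N where "N = real n ^ (k - 1)"
    have Np: "N > 0" using np by (simp add: N_def)
    have nk: "real n ^ k = real n * N" and kk: "real k ^ k = real k * Q"
      using k by (simp_all add: N_def Q_def power_eq_if)
    have factle: "fact n \<le> real n * N * fact (n - k)"
    proof -
      have "fact n = fact n div fact (n - k) * (fact (n - k) :: nat)"
        by (simp add: fact_dvd)
      also have "\<dots> \<le> n ^ k * fact (n - k)"
        by (intro mult_right_mono fact_div_fact_le_pow n) simp
      finally have "real (fact n) \<le> real (n ^ k * fact (n - k))" by (simp only: of_nat_le_iff)
      then show ?thesis by (simp add: nk)
    qed
    have W: "N / Q \<le> W"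
    proof -
      have "real n * (N / Q) = real k * (real n / real k) ^ k"
        using kp Qp by (simp add: power_divide nk kk)
      also have "\<dots> \<le> real k * T"
        unfolding T_def by (intro mult_left_mono binomial_ge_n_over_k_pow_k n) simp
      also have "\<dots> = real n * W"
        unfolding T_def W_def by (rule choose_minus_one_times[OF k1 n, symmetric])
      finally show ?thesis by (rule mult_left_le_imp_le) (rule np)
    qed

    have "(fact (n - k) * ((real m)\<^sup>2 * (W\<^sup>2 / (2 * real k))))\<^sup>2 \<le> (fact (n - k) * D)\<^sup>2"
      using D by (simp only: power_mult_distrib) (intro mult_left_mono, auto)
    also note CS
    also have "(fact n * V) * (fact n * \<nu>) = (fact n)\<^sup>2 * (V * \<nu>)"
      by (simp add: power2_eq_square)
    also have "\<dots> \<le> (real n * N * fact (n - k))\<^sup>2 * (V * \<nu>)"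
      using factle V0 np by (intro mult_right_mono power_mono) (auto simp: \<nu>_def)
    finally have "(fact (n - k))\<^sup>2 * (((real m)\<^sup>2)\<^sup>2 * (W\<^sup>2 / (2 * real k))\<^sup>2)
        \<le> (fact (n - k))\<^sup>2 * ((real n * N)\<^sup>2 * (V * \<nu>))"
      by (simp only: power_mult_distrib mult_ac)
    then have "((real m)\<^sup>2)\<^sup>2 * (W\<^sup>2 / (2 * real k))\<^sup>2 \<le> (real n * N)\<^sup>2 * (V * \<nu>)"
      by (rule mult_left_le_imp_le) simp
    also have "\<dots> = (real m)\<^sup>2 * (real n * N\<^sup>2 * V)"
      using np by (simp add: \<nu>_def power2_eq_square)
    finally have "(real m)\<^sup>2 * ((real m)\<^sup>2 * (W\<^sup>2 / (2 * real k))\<^sup>2) \<le> (real m)\<^sup>2 * (real n * N\<^sup>2 * V)"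
      by (simp only: power2_eq_square mult.assoc)
    then have main: "(real m)\<^sup>2 * (W\<^sup>2 / (2 * real k))\<^sup>2 \<le> real n * N\<^sup>2 * V"
      by (rule mult_left_le_imp_le) (use m1 in simp)
    \<comment> \<open>Inserting \<open>m \<ge> n / (8 k\<^sup>2)\<close> and \<open>W \<ge> (n / k) ^ (k - 1)\<close> leaves the constant
        \<open>1 / (64 k ^ 4) * 1 / (4 k\<^sup>2) * 1 / Q ^ 4\<close>.\<close>
    have "(real n / (8 * (real k)\<^sup>2))\<^sup>2 * ((N / Q)\<^sup>2 / (2 * real k))\<^sup>2
        \<le> (real m)\<^sup>2 * (W\<^sup>2 / (2 * real k))\<^sup>2"
      using m_ge W np Np Qp kp by (intro mult_mono power_mono divide_right_mono) auto
    also note main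
    finally have "(real n * N\<^sup>2) * (1 / (256 * real k ^ 6 * Q ^ 4) * (real n * N\<^sup>2)) \<le> (real n * N\<^sup>2) * V"
      using kp Qp by (simp add: power_divide power_mult_distrib field_simps eval_nat_numeral)
    then have "1 / (256 * real k ^ 6 * Q ^ 4) * (real n * N\<^sup>2) \<le> V"
      by (rule mult_left_le_imp_le) (use np Np in simp)
    moreover have "real n * N\<^sup>2 = real n ^ (2 * k - 1)"
    proof -
      have "2 * k - 1 = Suc ((k - 1) * 2)" using k by simp
      then show ?thesis by (simp only: N_def power_mult power_Suc)
    qed
    ultimately show ?thesis by (simp only: V_def X_def)
  qed
  moreover have "1 / (256 * real k ^ 6 * Q ^ 4) > 0" using kp Qp by simp
  ultimately show ?thesis by blast
qed

end
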